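(* Let $k,m\ge 0$ be integers. We have the following factorizations in irreducible factors in $\mathbb{Q}[t]$: $$ V_{2^k(2m+1)} = \prod_{d\mid 2m+1}\left(\prod_{i=1}^k M_d(T_{2^i})\right)\cdot M_d(t)\,M_d(-t), $$ $$ T_{2^k(2m+1)}=\frac12\prod_{d\mid 2m+1}M_d(T_{2^{k+1}}), $$ where $M_n$ is the minimal polynomial of $\cos\frac{\pi}{n}$ and the products run over all positive divisors $d$ of $2m+1$.
   Context: $T_n$ and $V_n$ are the Chebyshev polynomials of the first and second kind in the variable $t$: $T_0=1$, $T_1=t$, $T_{n+1}=2tT_n-T_{n-1}$, and $V_0=0$, $V_1=1$, $V_{n+1}=2tV_n-V_{n-1}$; thus $T_n(\cos\theta)=\cos n\theta$ and $V_n(\cos\theta)=\frac{\sin n\theta}{\sin\theta}$. $M_n$ denotes the minimal polynomial of $\cos\frac{\pi}{n}$ over $\mathbb{Q}$; for $n>1$ it has degree $\frac12\varphi(2n)$ and is normalized to have leading coefficient $2^{\varphi(2n)/2}$, where $\varphi$ is Euler's function.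
   Formalization: As printed both identities fail (k=m=0: V_1=1 is not 1-t^2, T_1=t is not t^2; V_3=-M_3(t)M_3(-t)). Corrected: for d=1, M_1(T_{2^i}) is replaced by M_{2^i} and M_1(t)M_1(-t) is dropped; the V-product gets the sign (-1)^m. *)

theory Defs
  imports
    "HOL-Analysis.Analysis"
    "HOL-Computational_Algebra.Computational_Algebra"
    "HOL-Number_Theory.Totient"
begin

fun cheb_T :: "nat \<Rightarrow> rat poly" where
  "cheb_T 0 = 1"
| "cheb_T (Suc 0) = [:0, 1:]"
| "cheb_T (Suc (Suc n)) = [:0, 2:] * cheb_T (Suc n) - cheb_T n"

(* Indexed so that, for n > 0, cheb_V n has degree n - 1. *)
fun cheb_V :: "nat \<Rightarrow> rat poly" where
  "cheb_V 0 = 0"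
| "cheb_V (Suc 0) = 1"
| "cheb_V (Suc (Suc n)) = [:0, 2:] * cheb_V (Suc n) - cheb_V n"

abbreviation rpoly :: "rat poly \<Rightarrow> real \<Rightarrow> real" where
  "rpoly p \<equiv> poly (map_poly of_rat p)"

definition is_min_poly :: "real \<Rightarrow> rat poly \<Rightarrow> bool" where
  "is_min_poly x p \<longleftrightarrow> lead_coeff p = 1 \<and> rpoly p x = 0 \<and>
     (\<forall>q. q \<noteq> 0 \<longrightarrow> rpoly q x = 0 \<longrightarrow> degree p \<le> degree q)"

(* Only meaningful for x algebraic over the rationals. *)
definition min_poly :: "real \<Rightarrow> rat poly" where
  "min_poly x = (THE p. is_min_poly x p)"

(* For n > 1 the exponent is the degree of the minimal polynomial of cos (pi / n).
   For n = 1 natural-number division makes the exponent 0, and M 1 = t + 1. *)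
definition M :: "nat \<Rightarrow> rat poly" where
  "M n = smult (2 ^ (totient (2 * n) div 2)) (min_poly (cos (pi / real n)))"

lemma rpoly_pCons [simp]: "rpoly (pCons a p) x = of_rat a + x * rpoly p x"
  by (simp add: map_poly_pCons)

lemma rpoly_add [simp]: "rpoly (p + q) x = rpoly p x + rpoly q x"
proof -
  have "map_poly (of_rat :: rat \<Rightarrow> real) (p + q) = map_poly of_rat p + map_poly of_rat q"
    by (rule poly_eqI) (simp add: coeff_map_poly of_rat_add)
  thus ?thesis by simp
qed

lemma rpoly_smult [simp]: "rpoly (smult c p) x = of_rat c * rpoly p x"
  by (simp add: map_poly_smult of_rat_mult)

lemma rpoly_diff [simp]: "rpoly (p - q) x = rpoly p x - rpoly q x"
  using rpoly_add[of "p - q" q x] by simp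

lemma rpoly_mult [simp]: "rpoly (p * q) x = rpoly p x * rpoly q x"
  by (induction p) (simp_all add: algebra_simps)

lemma is_min_poly_unique:
  assumes "is_min_poly x p" "is_min_poly x q"
  shows "p = q"
proof (rule ccontr)
  assume "p \<noteq> q"
  have deg: "degree p = degree q"
    using assms unfolding is_min_poly_def
    by (metis antisym leading_coeff_0_iff zero_neq_one)
  have "rpoly (p - q) x = 0" using assms by (simp add: is_min_poly_def)
  moreover have "p - q \<noteq> 0" using \<open>p \<noteq> q\<close> by simp
  ultimately have le: "degree p \<le> degree (p - q)"
    using assms unfolding is_min_poly_def by blast
  have "degree (p - q) \<le> degree p" using deg by (simp add: degree_diff_le)
  hence "degree (p - q) = degree p" using le by simp
  hence "lead_coeff (p - q) = 0" using assms deg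
    unfolding is_min_poly_def by (metis coeff_diff diff_self)
  with \<open>p - q \<noteq> 0\<close> show False by (metis leading_coeff_0_iff)
qed

lemma min_poly_eqI: "is_min_poly x p \<Longrightarrow> min_poly x = p"
  unfolding min_poly_def by (rule the_equality) (auto intro: is_min_poly_unique)

lemma is_min_poly_min_poly:
  assumes "q \<noteq> 0" "rpoly q x = 0"
  shows "is_min_poly x (min_poly x)"
proof -
  define Q where "Q = (\<lambda>q. q \<noteq> 0 \<and> rpoly q x = 0)"
  define p where "p = arg_min degree Q"
  have "Q q" using assms by (simp add: Q_def)
  hence p: "Q p" "\<And>r. Q r \<Longrightarrow> degree p \<le> degree r"
    unfolding p_def by (auto intro: arg_min_natI arg_min_nat_le)
  have "is_min_poly x (smult (inverse (lead_coeff p)) p)"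
    using p by (auto simp: is_min_poly_def Q_def)
  thus ?thesis using min_poly_eqI by metis
qed

lemma cheb_T_cos: "rpoly (cheb_T n) (cos t) = cos (real n * t)"
proof (induction n rule: cheb_T.induct)
  case (3 n)
  have "cos (real (Suc (Suc n)) * t) + cos (real n * t) = 2 * cos t * cos (real (Suc n) * t)"
    using cos_add[of "real (Suc n) * t" t] cos_diff[of "real (Suc n) * t" t]
    by (simp add: algebra_simps)
  with 3 show ?case by (simp add: algebra_simps)
qed simp_all

lemma cheb_V_cos: "sin t * rpoly (cheb_V n) (cos t) = sin (real n * t)"
proof (induction n rule: cheb_V.induct)
  case (3 n)
  have "sin (real (Suc (Suc n)) * t) + sin (real n * t) = 2 * cos t * sin (real (Suc n) * t)"
    using sin_add[of "real (Suc n) * t" t] sin_diff[of "real (Suc n) * t" t]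
    by (simp add: algebra_simps)
  with 3 show ?case by (simp add: algebra_simps)
qed simp_all

lemma is_min_poly_cos: "is_min_poly (cos (pi / real n)) (min_poly (cos (pi / real n)))"
proof (cases "n = 0")
  case True
  thus ?thesis by (intro is_min_poly_min_poly[of "[:-1, 1:]"]) simp_all
next
  case False
  have "rpoly (cheb_T n + 1) (cos (pi / real n)) = 0"
    using False by (simp add: cheb_T_cos)
  moreover have "cheb_T n + 1 \<noteq> 0"
  proof
    assume "cheb_T n + 1 = 0"
    hence "rpoly (cheb_T n + 1) (cos 0) = 0" by simp
    thus False unfolding rpoly_add cheb_T_cos by simp
  qed
  ultimately show ?thesis by (intro is_min_poly_min_poly)
qed

lemma is_min_poly_linear:
  assumes "x = of_rat a" shows "is_min_poly x [:-a, 1:]"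
proof -
  have "1 \<le> degree q" if "q \<noteq> 0" "rpoly q x = 0" for q :: "rat poly"
  proof (rule ccontr)
    assume "\<not> 1 \<le> degree q"
    then obtain c where "q = [:c:]" using degree_eq_zeroE[of q] by (auto simp: not_le)
    thus False using that by simp
  qed
  thus ?thesis using assms by (auto simp: is_min_poly_def of_rat_minus)
qed

lemma M_1: "M 1 = [:1, 1:]"
proof -
  have "min_poly (-1) = [:1, 1:]"
    using min_poly_eqI[OF is_min_poly_linear[of "-1" "-1"]] by (simp add: of_rat_minus)
  thus ?thesis by (simp add: M_def totient_2)
qed

lemma M_2: "M 2 = [:0, 2:]"
proof -
  have "min_poly 0 = [:0, 1:]" using min_poly_eqI[OF is_min_poly_linear[of 0 0]] by simp
  moreover have "totient 4 = 2" using totient_prime_power[of 2 2] by simp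
  ultimately show ?thesis by (simp add: M_def)
qed

lemma M_3: "M 3 = [:-1, 2:]"
proof -
  have "min_poly (1 / 2) = [:-(1 / 2), 1:]"
    using min_poly_eqI[OF is_min_poly_linear[of "1 / 2" "1 / 2"]] by (simp add: of_rat_divide)
  moreover have "totient 6 = 2"
    using totient_mult_coprime[of 2 3] totient_prime[of 3] by (simp add: totient_2)
  ultimately show ?thesis by (simp add: M_def cos_60)
qed

(* Why the factorizations carry a sign (-1)^m and treat d = 1 apart.
   Sign: M d (-t) has leading coefficient of sign (-1)^degree, as in V_3 below.
   The divisor d = 1: unlike for odd d > 1, M 1 (T_(2^i)) is not M (2^i) but half its
   square, and M 1 (t) M 1 (-t) = 1 - t^2 never divides V_n.  So d = 1 contributes the
   factors M (2^i) to the products and nothing in place of M 1 (t) M 1 (-t). *)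

lemma cheb_V_3: "cheb_V 3 = - (M 3 * (M 3 \<circ>\<^sub>p [:0, -1:]))"
  unfolding M_3 by (simp add: numeral_3_eq_3 pcompose_pCons one_pCons)

lemma M_1_cheb_T_2: "M 1 \<circ>\<^sub>p cheb_T 2 = smult (1 / 2) ((M 2)\<^sup>2)"
  unfolding M_1 M_2 power2_eq_square
  by (simp add: numeral_2_eq_2 pcompose_pCons one_pCons)

lemma M_1_not_dvd_cheb_V:
  assumes "n > 0" shows "\<not> (M 1 * (M 1 \<circ>\<^sub>p [:0, -1:])) dvd cheb_V n"
proof
  assume "(M 1 * (M 1 \<circ>\<^sub>p [:0, -1:])) dvd cheb_V n"
  hence "poly (cheb_V n) 1 = 0"
    unfolding M_1 by (auto simp: poly_pcompose elim!: dvdE)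
  moreover have "poly (cheb_V n) 1 = of_nat n" by (induction n rule: cheb_V.induct) simp_all
  ultimately show False using assms by simp
qed

end

(* The polynomials M d, M d(-t) and M (2^i d) occurring on the right-hand sides are irreducible,
   pairwise coprime and divide the left-hand side.  Each M n (n > 1) has degree at least
   totient (2 n) / 2, because every cos (pi j / n) with j coprime to 2 n is a root (irreducibility of
   cyclotomic polynomials).  As the totients of the divisors of n sum to n, these lower bounds
   already add up to the degree of the left-hand side, so all of them are equalities.  Comparing
   degrees once more gives M d (T_(2^i)) = M (2^i d) for odd d > 1, and V_(2 n) = 2 T_n V_n reduces
   V_(2^k (2 m + 1)) to V_(2 m + 1). *)

theory Submission
  imports Defs "HOL-Computational_Algebra.Field_as_Ring"
begin

section \<open>Conjugates of roots of unity\<close>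

lemma prime_dvd_power_add_diff:
  fixes x y :: "'a :: comm_ring_1"
  assumes "prime p"
  shows "of_nat p dvd (x + y) ^ p - (x ^ p + y ^ p)"
proof -
  let ?c = "\<lambda>k. of_nat (p choose k) * x ^ k * y ^ (p - k)"
  have p: "p > 0" using assms by (simp add: prime_gt_0_nat)
  have "{..p} = insert 0 (insert p {0<..<p})" using p by auto
  hence "(x + y) ^ p = x ^ p + y ^ p + (\<Sum>k\<in>{0<..<p}. ?c k)"
    using p by (simp add: binomial_ring)
  \<comment> \<open>Every binomial coefficient strictly between the two ends of the row is divisible
    by the prime p.\<close>
  moreover have "of_nat p dvd (\<Sum>k\<in>{0<..<p}. ?c k)"
  proof (rule dvd_sum)
    fix k assume "k \<in> {0<..<p}"
    hence "p dvd p choose k" using assms by (auto intro!: dvd_choose_prime)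
    hence "(of_nat p :: 'a) dvd of_nat (p choose k)" by auto
    thus "of_nat p dvd ?c k" by (simp add: mult.assoc dvd_mult2)
  qed
  ultimately show ?thesis by simp
qed

text \<open>Fermat's little theorem: a -> a^p is additive modulo p and fixes 0 and 1. The induction
  runs in both directions from 0, so it covers negative integers.\<close>

lemma prime_dvd_int_power_diff:
  fixes a :: int
  assumes "prime p"
  shows "int p dvd a ^ p - a"
proof (induction a rule: int_induct[where k = 0])
  case base
  show ?case using prime_gt_0_nat[OF assms] by (simp add: power_0_left)
next
  case (step1 i)
  have "(i + 1) ^ p - (i + 1) = ((i + 1) ^ p - (i ^ p + 1 ^ p)) + (i ^ p - i)" by simp
  thus ?case using prime_dvd_power_add_diff[OF assms, of i 1] step1 by (metis dvd_add of_nat_id of_int_of_nat_eq)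
next
  case (step2 i)
  have "(i - 1) ^ p - (i - 1) = (i ^ p - i) - ((i - 1 + 1) ^ p - ((i - 1) ^ p + 1 ^ p))" by simp
  thus ?case using prime_dvd_power_add_diff[OF assms, of "i - 1" 1] step2 by (metis dvd_diff)
qed

text \<open>The congruence f(X)^p = f(X^p) modulo p, along the Horner form a + X * f: Fermat handles
  the constant, additivity of the p-th power the sum, and the induction hypothesis the tail.\<close>

lemma prime_dvd_poly_power_diff:
  fixes f :: "int poly"
  assumes "prime p"
  shows "of_nat p dvd f ^ p - f \<circ>\<^sub>p ([:0, 1:] ^ p)"
proof (induction f)
  case 0
  show ?case using prime_gt_0_nat[OF assms] by (simp add: power_0_left)
next
  case (pCons a f)
  let ?X = "[:0, 1:] :: int poly"
  obtain b where "a ^ p - a = int p * b" using prime_dvd_int_power_diff[OF assms] by (auto elim: dvdE)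
  hence "[:a:] ^ p - [:a:] = of_nat p * [:b:]"
    by (simp add: poly_const_pow of_nat_poly)
  hence "of_nat p dvd [:a:] ^ p - [:a:]" by (metis dvd_triv_left)
  moreover have "of_nat p dvd ([:a:] + ?X * f) ^ p - ([:a:] ^ p + (?X * f) ^ p)"
    by (rule prime_dvd_power_add_diff[OF assms])
  moreover have "of_nat p dvd ?X ^ p * (f ^ p - f \<circ>\<^sub>p (?X ^ p))" using pCons(2) by (rule dvd_mult)
  ultimately have "of_nat p dvd ([:a:] ^ p - [:a:]) +
      (([:a:] + ?X * f) ^ p - ([:a:] ^ p + (?X * f) ^ p)) + ?X ^ p * (f ^ p - f \<circ>\<^sub>p (?X ^ p))"
    by (intro dvd_add)
  also have "\<dots> = ([:a:] + ?X * f) ^ p - pCons a f \<circ>\<^sub>p (?X ^ p)"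
    by (simp add: pcompose_pCons power_mult_distrib right_diff_distrib del: mult_pCons_left)
  also have "[:a:] + ?X * f = pCons a f" by simp
  finally show ?case .
qed

section \<open>Evaluation of integer polynomials at complex numbers\<close>

abbreviation ipoly :: "int poly \<Rightarrow> complex \<Rightarrow> complex" where
  "ipoly p \<equiv> poly (map_poly of_int p)"

lemma ipoly_pCons [simp]: "ipoly (pCons a p) x = of_int a + x * ipoly p x"
  by (simp add: map_poly_pCons)

lemma ipoly_add [simp]: "ipoly (p + q) x = ipoly p x + ipoly q x"
proof -
  have "map_poly (of_int :: int \<Rightarrow> complex) (p + q) = map_poly of_int p + map_poly of_int q"
    by (rule poly_eqI) (simp add: coeff_map_poly)
  thus ?thesis by simp
qed

lemma ipoly_smult [simp]: "ipoly (smult c p) x = of_int c * ipoly p x"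
  by (simp add: map_poly_smult)

lemma ipoly_diff [simp]: "ipoly (p - q) x = ipoly p x - ipoly q x"
  using ipoly_add[of "p - q" q x] by simp

lemma ipoly_minus [simp]: "ipoly (-p) x = - ipoly p x"
  using ipoly_diff[of 0 p x] by simp

lemma ipoly_mult [simp]: "ipoly (p * q) x = ipoly p x * ipoly q x"
  by (induction p) (simp_all add: algebra_simps)

lemma ipoly_1 [simp]: "ipoly 1 x = 1"
  by (simp add: one_pCons)

lemma ipoly_of_nat [simp]: "ipoly (of_nat n) x = of_nat n"
  by (simp add: of_nat_poly)

lemma ipoly_power [simp]: "ipoly (p ^ n) x = ipoly p x ^ n"
  by (induction n) simp_all

lemma ipoly_pcompose [simp]: "ipoly (p \<circ>\<^sub>p q) x = ipoly p (ipoly q x)"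
  by (induction p) (simp_all add: pcompose_pCons)

text \<open>The minimal polynomial of a root of unity is monic with integer coefficients (Gauss).\<close>

lemma root_of_unity_int_min_poly:
  fixes z :: complex
  assumes "N > 0" "z ^ N = 1"
  obtains f where "lead_coeff f = 1" "ipoly f z = 0" "\<And>g. ipoly g z = 0 \<Longrightarrow> f dvd g"
proof -
  define Q where "Q = (\<lambda>q. q \<noteq> 0 \<and> ipoly q z = 0)"
  let ?X = "[:0, 1:] :: int poly"
  have X: "ipoly (?X ^ N - 1) z = 0" using assms by simp
  have lcX: "lead_coeff (?X ^ N - 1) = 1"
  proof -
    have "degree (1 :: int poly) < degree (?X ^ N)" using assms by (simp add: degree_power_eq)
    hence "lead_coeff (?X ^ N - 1) = lead_coeff (?X ^ N)"
      using lead_coeff_add_le[of "-1" "?X ^ N"] by (simp add: lead_coeff_add_le)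
    thus ?thesis by (simp add: lead_coeff_power)
  qed
  hence "Q (?X ^ N - 1)" using X unfolding Q_def by fastforce
  define q0 where "q0 = arg_min degree Q"
  have q0: "Q q0" "\<And>r. Q r \<Longrightarrow> degree q0 \<le> degree r"
    unfolding q0_def using \<open>Q (?X ^ N - 1)\<close> by (auto intro: arg_min_natI arg_min_nat_le)
  \<comment> \<open>Passing to the primitive part of a minimal-degree annihilator allows division by
    q inside the integer polynomials, although q is not yet known to be monic.\<close>
  define q where "q = primitive_part q0"
  have nz: "q \<noteq> 0" and cont: "content q = 1" and deg: "degree q = degree q0"
    using q0 by (auto simp: q_def Q_def)
  have "ipoly q0 z = of_int (content q0) * ipoly q z"
    unfolding q_def by (metis ipoly_smult content_times_primitive_part)
  hence qz: "ipoly q z = 0" using q0 by (auto simp: Q_def)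
  have dvd: "q dvd g" if g: "ipoly g z = 0" for g
  proof -
    obtain s r where sr: "pseudo_divmod g q = (s, r)" by fastforce
    define c where "c = coeff q (degree q) ^ (Suc (degree g) - degree q)"
    have c: "c \<noteq> 0" using nz by (simp add: c_def)
    have eq: "smult c g = q * s + r" and r: "r = 0 \<or> degree r < degree q"
      using pseudo_divmod[OF nz sr] by (simp_all add: c_def)
    have "ipoly (smult c g) z = ipoly (q * s + r) z" by (simp only: eq)
    hence "ipoly r z = 0" using qz g by simp
    hence "r = 0" using r q0(2)[of r] deg by (auto simp: Q_def simp flip: not_less)
    hence eq: "smult c g = q * s" using eq by simp
    \<comment> \<open>Since q has content 1, the pseudo-division factor c must divide all of s and
      can be cancelled.\<close>
    hence "content (smult c g) = content s" using cont by (simp add: content_mult)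
    hence "c dvd content s" by (metis content_smult dvd_triv_left normalize_dvd_iff)
    hence "[:c:] dvd s" by (simp add: const_poly_dvd_iff_dvd_content)
    then obtain s' where "s = smult c s'" by (auto elim!: dvdE)
    hence "smult c (g - q * s') = 0" using eq by (simp add: smult_diff_right)
    hence "g = q * s'" using c by simp
    thus ?thesis by simp
  qed
  \<comment> \<open>q divides the monic polynomial X^N - 1, so its leading coefficient is 1 or -1;
    scaling by that sign makes it monic.\<close>
  have "lead_coeff q dvd 1" using dvd[OF X] lcX by (metis dvdE dvd_triv_left lead_coeff_mult)
  hence "lead_coeff q * lead_coeff q = 1" by (metis abs_mult_self_eq zdvd1_eq mult_1)
  hence l: "lead_coeff (smult (lead_coeff q) q) = 1" using nz by simp
  have "smult (lead_coeff q) q dvd g" if "ipoly g z = 0" for g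
  proof -
    from dvd[OF that] obtain k where "g = q * k" by (elim dvdE)
    hence "g = smult (lead_coeff q) q * smult (lead_coeff q) k"
      using \<open>lead_coeff q * lead_coeff q = 1\<close> by simp
    thus ?thesis by (metis dvd_triv_left)
  qed
  thus ?thesis using that[OF l] qz by simp
qed

text \<open>If the minimal polynomial \<open>f\<close> of \<open>z\<close> did not vanish at \<open>z\<^sup>p\<close>, then differentiating \<open>X\<^sup>N - 1 = f h\<close> at
  \<open>z\<^sup>p\<close> would show that \<open>f (z\<^sup>p)\<close>, which is a multiple of \<open>p\<close> in \<open>\<int>[z]\<close>, divides \<open>N\<close> there.\<close>

lemma root_of_unity_conj_prime:
  fixes z :: complex
  assumes N: "N > 0" "z ^ N = 1" and p: "prime p" "\<not> p dvd N" and g: "ipoly g z = 0"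
  shows "ipoly g (z ^ p) = 0"
proof -
  let ?X = "[:0, 1:] :: int poly"
  obtain f where f: "lead_coeff f = 1" "ipoly f z = 0" "\<And>g. ipoly g z = 0 \<Longrightarrow> f dvd g"
    using root_of_unity_int_min_poly[OF N] by metis
  have "ipoly f (z ^ p) = 0"
  proof (rule ccontr)
    assume nz: "ipoly f (z ^ p) \<noteq> 0"
    have "f dvd ?X ^ N - 1" using N by (intro f) simp
    then obtain h where h: "?X ^ N - 1 = f * h" by (elim dvdE)
    have "ipoly (?X ^ N - 1) (z ^ p) = 0" using N by (simp add: power_mult[symmetric] mult.commute) (simp add: power_mult)
    hence hz: "ipoly h (z ^ p) = 0" using nz unfolding h by simp
    have "pderiv (?X ^ N - 1) = f * pderiv h + h * pderiv f" unfolding h by (rule pderiv_mult)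
    moreover have "pderiv (?X ^ N - 1) = smult (int N) (?X ^ (N - 1))"
      by (simp add: pderiv_diff pderiv_power pderiv_pCons)
    ultimately have "ipoly (smult (int N) (?X ^ (N - 1))) (z ^ p) = ipoly (f * pderiv h + h * pderiv f) (z ^ p)"
      by simp
    hence "of_nat N * (z ^ p) ^ (N - 1) = ipoly f (z ^ p) * ipoly (pderiv h) (z ^ p)"
      using hz by simp
    \<comment> \<open>The extra factor \<open>z ^ p\<close> completes the power to
      \<open>(z ^ p) ^ N = 1\<close>, leaving N alone on the left.\<close>
    hence "of_nat N * (z ^ p) ^ (N - 1) * z ^ p = ipoly f (z ^ p) * ipoly (pderiv h) (z ^ p) * z ^ p"
      by simp
    moreover have "(z ^ p) ^ (N - 1) * z ^ p = 1"
    proof -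
      have "(z ^ p) ^ (N - 1) * z ^ p = (z ^ p) ^ N" using N by (metis power_minus_mult)
      also have "\<dots> = (z ^ N) ^ p" by (simp add: power_mult[symmetric] mult.commute)
      finally show ?thesis using N by simp
    qed
    ultimately have 1: "ipoly f (z ^ p) * ipoly (pderiv h) (z ^ p) * z ^ p = of_nat N"
      by (simp only: mult.assoc mult_1_right)
    obtain u where "f ^ p - f \<circ>\<^sub>p (?X ^ p) = of_nat p * u"
      using prime_dvd_poly_power_diff[OF p(1), of f] by (elim dvdE)
    hence "ipoly (f ^ p - f \<circ>\<^sub>p (?X ^ p)) z = ipoly (of_nat p * u) z" by simp
    hence "ipoly f z ^ p - ipoly f (z ^ p) = of_nat p * ipoly u z" by simp
    moreover have "ipoly f z ^ p = 0" using f(2) prime_gt_0_nat[OF p(1)] by (simp add: power_0_left)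
    ultimately have 2: "ipoly f (z ^ p) = - of_nat p * ipoly u z"
      by (metis add.inverse_inverse diff_0 mult_minus_left)
    \<comment> \<open>Replacing f(z^p) by -p u(z) in fact \<open>1\<close>, and writing values at
      z^p as values at z via composition with X^p, exhibits N as p times an integer polynomial in
      z.\<close>
    define w where "w = - u * (pderiv h \<circ>\<^sub>p (?X ^ p)) * ?X ^ p"
    have w: "of_nat p * ipoly w z = of_nat N"
      using 1 2 by (simp add: w_def mult_ac)
    have fnz: "f \<noteq> 0" using f by auto
    \<comment> \<open>As f is monic, pseudo-division is genuine division with remainder over the
      integers.\<close>
    obtain s r where sr: "pseudo_divmod w f = (s, r)" by fastforce
    have eq: "w = f * s + r" and r: "r = 0 \<or> degree r < degree f"
      using pseudo_divmod[OF fnz sr] f(1) by simp_all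
    \<comment> \<open>e vanishes at z, so f divides it, but its degree is below that of f. Hence e =
      0, and its constant coefficient gives the contradiction that p divides N.\<close>
    define e where "e = of_nat p * r - of_nat N"
    have "ipoly w z = ipoly r z" using f(2) eq by simp
    hence "f dvd e" using w by (intro f) (simp add: e_def)
    have degf: "degree f > 0"
    proof (rule ccontr)
      assume "\<not> degree f > 0"
      then obtain a where "f = [:a:]" using degree_eq_zeroE[of f] by auto
      thus False using f by auto
    qed
    have "degree e < degree f"
    proof -
      have "degree (of_nat p * r) \<le> degree r" by (simp add: of_nat_poly)
      hence "degree (of_nat p * r) < degree f" using r degf by auto
      moreover have "degree (of_nat N :: int poly) < degree f" using degf by simp
      ultimately show ?thesis unfolding e_def by (intro degree_diff_less)
    qed
    hence "e = 0" using \<open>f dvd e\<close> by (metis dvd_imp_degree_le leD)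
    hence "coeff (of_nat p * r) 0 = coeff (of_nat N) 0" by (simp add: e_def)
    hence "int p * coeff r 0 = int N" by (simp add: of_nat_poly)
    hence "int p dvd int N" by (metis dvd_triv_left)
    thus False using p by simp
  qed
  moreover obtain q where "g = f * q" using f(3)[OF g] by (elim dvdE)
  ultimately show ?thesis by simp
qed

text \<open>The prime factors of j are applied one at a time. The induction generalizes z because,
  after a step, the hypotheses are used for the root of unity z^p.\<close>

lemma root_of_unity_conj:
  fixes z :: complex
  assumes N: "N > 0" and j: "coprime j N" and z: "z ^ N = 1" "ipoly g z = 0"
  shows "ipoly g (z ^ j) = 0"
  using j z
proof (induction j arbitrary: z rule: prime_divisors_induct)
  case zero
  thus ?case by simp
next
  case (unit j)
  thus ?case by simp
next
  case (factor p j)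
  have "\<not> p dvd N" using factor by (metis coprime_mult_left_iff coprime_absorb_left not_prime_unit)
  hence "ipoly g (z ^ p) = 0" using root_of_unity_conj_prime[OF N, of z p g] factor by simp
  moreover have "(z ^ p) ^ N = 1" using factor by (metis power_mult mult.commute power_one)
  ultimately have "ipoly g ((z ^ p) ^ j) = 0" using factor by simp
  thus ?case by (simp add: power_mult)
qed

text \<open>With z = cis t one has cos t = (z^2 + 1) / (2 z); a power of z and an integer clear all
  denominators. The same c, d and G serve every t, so zeros can be compared at different
  angles.\<close>

lemma rpoly_cos_eq_ipoly_cis:
  obtains c d G where "c \<noteq> 0"
    "\<And>t. ipoly G (cis t) = of_int c * cis t ^ d * of_real (rpoly f (cos t))"
proof -
  let ?X = "[:0, 1:] :: int poly"
  have "\<exists>c d G. c \<noteq> 0 \<and> (\<forall>t. ipoly G (cis t) = of_int c * cis t ^ d * of_real (rpoly f (cos t)))"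
  proof (induction f)
    case 0
    show ?case by (intro exI[of _ 1] exI[of _ 0]) simp
  next
    case (pCons a f)
    then obtain c d G where *: "c \<noteq> 0"
      "\<And>t. ipoly G (cis t) = of_int c * cis t ^ d * of_real (rpoly f (cos t))" by auto
    obtain n m where a: "a = of_int n / of_int m" "m > 0" by (metis quotient_of_div quotient_of_denom_pos surj_pair)
    have am: "of_int m * of_real (of_rat a) = (of_int n :: complex)"
      using a by (simp add: of_rat_divide)
    \<comment> \<open>A Horner step for a + x * f with a = n / m: it raises the power of z by one
      and multiplies the integer factor by 2 m.\<close>
    define G' where "G' = smult (2 * c * n) (?X ^ (d + 1)) + smult m ((?X\<^sup>2 + 1) * G)"
    have "ipoly G' (cis t) = of_int (2 * c * m) * cis t ^ (d + 1) * of_real (rpoly (pCons a f) (cos t))" for t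
    proof -
      have sq: "(cis t)\<^sup>2 + 1 = 2 * of_real (cos t) * cis t"
        by (simp add: complex_eq_iff power2_eq_square cos_squared_eq algebra_simps)
      have "ipoly G' (cis t) = of_int (2 * c) * cis t ^ (d + 1) * of_int n +
          of_int m * ((cis t)\<^sup>2 + 1) * ipoly G (cis t)"
        by (simp add: G'_def algebra_simps)
      also have "\<dots> = of_int (2 * c) * cis t ^ (d + 1) * (of_int m * of_real (of_rat a)) +
          of_int m * (2 * of_real (cos t) * cis t) * (of_int c * cis t ^ d * of_real (rpoly f (cos t)))"
        by (simp only: am sq *(2))
      finally show ?thesis by (simp add: algebra_simps)
    qed
    moreover have "2 * c * m \<noteq> 0" using * a by simp
    ultimately show ?case by blast
  qed
  thus ?thesis using that by blast
qed

lemma rpoly_cos_conj: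
  assumes "N > 0" "coprime j N" "cis t ^ N = 1" "rpoly f (cos t) = 0"
  shows "rpoly f (cos (real j * t)) = 0"
proof -
  obtain c d G where G: "c \<noteq> 0"
    "\<And>t. ipoly G (cis t) = of_int c * cis t ^ d * of_real (rpoly f (cos t))"
    using rpoly_cos_eq_ipoly_cis by metis
  have "ipoly G (cis t ^ j) = 0"
    by (rule root_of_unity_conj[OF assms(1,2,3)]) (simp add: G assms)
  hence "ipoly G (cis (real j * t)) = 0" by (simp add: Complex.DeMoivre)
  thus ?thesis using G by (simp add: cis_neq_zero)
qed

section \<open>Chebyshev polynomials\<close>

lemma rpoly_pcompose [simp]: "rpoly (p \<circ>\<^sub>p q) x = rpoly p (rpoly q x)"
  by (induction p) (simp_all add: pcompose_pCons)

lemma rpoly_1 [simp]: "rpoly 1 x = 1"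
  by (simp add: one_pCons)

lemma rpoly_dvd_root: "p dvd q \<Longrightarrow> rpoly p x = 0 \<Longrightarrow> rpoly q x = 0"
  by (auto elim: dvdE)

lemma degree_cheb_T: "degree (cheb_T n) = n"
  and lead_coeff_cheb_T: "n > 0 \<Longrightarrow> lead_coeff (cheb_T n) = 2 ^ (n - 1)"
proof -
  \<comment> \<open>At n = 0 truncated subtraction makes the exponent 0, so the coefficient claim
    holds there too.\<close>
  have "degree (cheb_T n) = n \<and> coeff (cheb_T n) n = 2 ^ (n - 1)"
  proof (induction n rule: cheb_T.induct)
    case (3 n)
    have "cheb_T (Suc n) \<noteq> 0" using 3 by auto
    hence d: "degree ([:0, 2:] * cheb_T (Suc n)) = Suc (Suc n)"
      using 3 by (subst degree_mult_eq) auto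
    hence "degree (cheb_T (Suc (Suc n))) = Suc (Suc n)"
      unfolding cheb_T.simps(3)[of n] diff_conv_add_uminus
      using 3 by (subst degree_add_eq_left) (auto simp del: cheb_T.simps mult_pCons_left)
    moreover have "coeff (cheb_T n) (Suc (Suc n)) = 0" using 3 by (intro coeff_eq_0) simp
    ultimately show ?case using 3 by simp
  qed simp_all
  thus "degree (cheb_T n) = n" "n > 0 \<Longrightarrow> lead_coeff (cheb_T n) = 2 ^ (n - 1)" by auto
qed

lemma degree_cheb_V: "degree (cheb_V (Suc n)) = n"
  and lead_coeff_cheb_V: "lead_coeff (cheb_V (Suc n)) = 2 ^ n"
proof -
  have "degree (cheb_V (Suc n)) = n \<and> coeff (cheb_V (Suc n)) n = 2 ^ n"
  \<comment> \<open>Here \<open>cheb_T.induct\<close> serves as plain two-step induction on the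
    shifted index.\<close>
  proof (induction n rule: cheb_T.induct)
    case (3 n)
    have "cheb_V (Suc (Suc n)) \<noteq> 0" using 3 by auto
    hence d: "degree ([:0, 2:] * cheb_V (Suc (Suc n))) = Suc (Suc n)"
      using 3 by (subst degree_mult_eq) (auto simp del: cheb_V.simps)
    hence "degree (cheb_V (Suc (Suc (Suc n)))) = Suc (Suc n)"
      unfolding cheb_V.simps(3)[of "Suc n"] diff_conv_add_uminus
      using 3 by (subst degree_add_eq_left) (auto simp del: cheb_V.simps mult_pCons_left)
    moreover have "coeff (cheb_V (Suc n)) (Suc (Suc n)) = 0" using 3 by (intro coeff_eq_0) simp
    ultimately show ?case using 3 unfolding cheb_V.simps(3)[of "Suc n"] by (simp del: cheb_V.simps)
  qed simp_all
  thus "degree (cheb_V (Suc n)) = n" "lead_coeff (cheb_V (Suc n)) = 2 ^ n" by auto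
qed

text \<open>This is sin((2n + c)x) + sin(cx) = 2 sin((n + c)x) cos(nx). Only c = 0 is wanted, but
  the recursion in n uses the instances c + 1 and c + 2.\<close>

lemma cheb_V_add_cheb_T:
  "cheb_V (2 * n + c) + cheb_V c = smult 2 (cheb_V (n + c) * cheb_T n)"
proof (induction n arbitrary: c rule: cheb_T.induct)
  case 1
  show ?case by (simp add: numeral_poly flip: mult_2)
next
  case (2 c)
  show ?case by (simp add: mult.commute)
next
  case (3 n)
  let ?t = "[:0, 2:] :: rat poly"
  have id: "t * (u + v) - (w + (t * v - x)) = t * u - w + x" for t u v w x :: "rat poly"
    by (simp add: algebra_simps)
  have "smult 2 (cheb_V (Suc (Suc n) + c) * cheb_T (Suc (Suc n))) =
      ?t * smult 2 (cheb_V (Suc n + Suc c) * cheb_T (Suc n)) - smult 2 (cheb_V (n + Suc (Suc c)) * cheb_T n)"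
    by (simp only: cheb_T.simps(3) add_Suc add_Suc_right right_diff_distrib smult_diff_right
          mult_smult_right mult_ac)
  also have "\<dots> = ?t * (cheb_V (2 * Suc n + Suc c) + cheb_V (Suc c)) -
      (cheb_V (2 * n + Suc (Suc c)) + (?t * cheb_V (Suc c) - cheb_V c))"
    by (simp only: 3[symmetric] cheb_V.simps(3))
  also have "\<dots> = ?t * cheb_V (2 * Suc n + Suc c) - cheb_V (2 * n + Suc (Suc c)) + cheb_V c"
    by (rule id)
  also have "\<dots> = cheb_V (2 * Suc (Suc n) + c) + cheb_V c"
    by (simp del: mult_pCons_left mult_pCons_right)
  finally show ?case ..
qed

lemma cheb_V_double: "cheb_V (2 * n) = smult 2 (cheb_V n * cheb_T n)"
  using cheb_V_add_cheb_T[of n 0] by simp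

section \<open>Minimal polynomials of \<open>cos (\<pi> / n)\<close>\<close>

lemma degree_M [simp]: "degree (M n) = degree (min_poly (cos (pi / real n)))"
  by (simp add: M_def)

lemma lead_coeff_M: "lead_coeff (M n) = 2 ^ (totient (2 * n) div 2)"
  using is_min_poly_cos[of n] unfolding M_def is_min_poly_def by (simp add: lead_coeff_smult)

lemma M_nonzero [simp]: "M n \<noteq> 0"
  using lead_coeff_M[of n] by force

lemma rpoly_M [simp]: "rpoly (M n) (cos (pi / real n)) = 0"
  using is_min_poly_cos[of n] by (simp add: M_def is_min_poly_def)

lemma degree_M_le: "q \<noteq> 0 \<Longrightarrow> rpoly q (cos (pi / real n)) = 0 \<Longrightarrow> degree (M n) \<le> degree q"
  using is_min_poly_cos[of n] by (simp add: is_min_poly_def)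

lemma M_dvd:
  assumes "rpoly q (cos (pi / real n)) = 0"
  shows "M n dvd q"
proof -
  have "rpoly q (cos (pi / real n)) = rpoly (q div M n * M n + q mod M n) (cos (pi / real n))"
    by simp
  also have "\<dots> = rpoly (q mod M n) (cos (pi / real n))"
    by (simp only: rpoly_add rpoly_mult rpoly_M mult_zero_right add_0_left)
  finally have "rpoly (q mod M n) (cos (pi / real n)) = 0" using assms by simp
  hence "q mod M n = 0"
    using degree_M_le[of "q mod M n" n] degree_mod_less[OF M_nonzero, of q n] by linarith
  thus ?thesis by (simp add: dvd_eq_mod_eq_0)
qed

lemma irreducible_M: "irreducible (M n)"
proof (rule irreducibleI)
  show "M n \<noteq> 0" by simp
  show "\<not> M n dvd 1"
  proof
    assume "M n dvd 1"
    from rpoly_dvd_root[OF this rpoly_M] show False by simp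
  qed
  \<comment> \<open>The factor vanishing at cos(pi / n) already has full degree by minimality, so
    the other one is a nonzero constant.\<close>
  have *: "b dvd 1" if eq: "M n = a * b" and a: "rpoly a (cos (pi / real n)) = 0" for a b
  proof -
    have nz: "a \<noteq> 0" "b \<noteq> 0" using eq M_nonzero[of n] by auto
    hence "degree (M n) = degree a + degree b" unfolding eq by (rule degree_mult_eq)
    hence "degree b = 0" using degree_M_le[OF nz(1) a] by linarith
    thus ?thesis using nz by (simp add: is_unit_iff_degree)
  qed
  fix a b assume eq: "M n = a * b"
  have "rpoly (a * b) (cos (pi / real n)) = 0" using rpoly_M[of n] unfolding eq .
  hence "rpoly a (cos (pi / real n)) = 0 \<or> rpoly b (cos (pi / real n)) = 0" by simp
  thus "a dvd 1 \<or> b dvd 1" using *[of a b] *[of b a] eq by (auto simp: mult.commute)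
qed

section \<open>The reflection t -> -t and coprimality of the factors\<close>

lemma pcompose_reflect_reflect: "p \<circ>\<^sub>p [:0, -1:] \<circ>\<^sub>p [:0, -1:] = (p :: 'a :: comm_ring_1 poly)"
  by (simp add: pcompose_assoc[symmetric] pcompose_pCons)

text \<open>Reflection is a ring automorphism of order two, so factorizations and units carry
  over.\<close>

lemma irreducible_pcompose_reflect:
  fixes p :: "'a :: field poly"
  assumes "irreducible p"
  shows "irreducible (p \<circ>\<^sub>p [:0, -1:])"
proof -
  have unit: "q \<circ>\<^sub>p [:0, -1:] dvd 1 \<longleftrightarrow> q dvd 1" for q :: "'a poly"
    by (cases "q = 0") (auto simp: is_unit_iff_degree pcompose_eq_0_iff degree_pcompose)
  show ?thesis
  proof (rule irreducibleI)
    show "p \<circ>\<^sub>p [:0, -1:] \<noteq> 0" using assms by (auto simp: pcompose_eq_0_iff)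
    show "\<not> p \<circ>\<^sub>p [:0, -1:] dvd 1" using assms by (auto simp: unit irreducible_def)
    fix a b assume "p \<circ>\<^sub>p [:0, -1:] = a * b"
    hence "p = (a \<circ>\<^sub>p [:0, -1:]) * (b \<circ>\<^sub>p [:0, -1:])"
      by (metis pcompose_mult pcompose_reflect_reflect)
    from irreducibleD[OF assms this] show "a dvd 1 \<or> b dvd 1" by (simp add: unit)
  qed
qed

lemma irreducible_coprime:
  fixes p q :: "'a :: algebraic_semidom"
  assumes "irreducible p" "\<not> p dvd q"
  shows "coprime p q"
proof (rule coprimeI)
  fix d assume d: "d dvd p" "d dvd q"
  then obtain e where e: "p = d * e" by (elim dvdE)
  show "d dvd 1"
  proof (rule ccontr)
    assume "\<not> d dvd 1"
    hence "e dvd 1" using irreducibleD[OF assms(1) e] by simp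
    hence "p dvd d" unfolding e by (simp add: mult_unit_dvd_iff)
    thus False using d assms(2) dvd_trans by blast
  qed
qed

text \<open>T_n takes the value cos pi = -1 at cos(pi / n), hence at every root of
  \<open>M n\<close>. This one value is what tells the different \<open>M n\<close> and their
  reflections apart.\<close>

lemma rpoly_M_imp_cheb_T:
  assumes "n > 0" "rpoly (M n) x = 0"
  shows "rpoly (cheb_T n) x = -1"
proof -
  have "M n dvd cheb_T n + 1" using assms by (intro M_dvd) (simp add: cheb_T_cos)
  from rpoly_dvd_root[OF this assms(2)] show ?thesis by simp
qed

text \<open>For a < b, a common factor would make cos(pi / b) a root of \<open>M a\<close>, forcing
  cos(a pi / b) = -1 at an angle strictly below pi.\<close>

lemma coprime_M:
  assumes "a > 0" "b > 0" "a \<noteq> b"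
  shows "coprime (M a) (M b)"
proof -
  have *: "coprime (M b) (M a)" if "a > 0" "a < b" for a b
  proof (intro irreducible_coprime irreducible_M notI)
    assume "M b dvd M a"
    from rpoly_M_imp_cheb_T[OF \<open>a > 0\<close> rpoly_dvd_root[OF this rpoly_M]]
    have "cos (real a * (pi / real b)) = -1" by (simp only: cheb_T_cos)
    moreover have "cos pi < cos (real a * (pi / real b))"
      using that by (intro cos_monotone_0_pi) (auto simp: field_simps)
    ultimately show False by simp
  qed
  show ?thesis using *[of a b] *[of b a] assms by (metis coprime_commute nat_neq_iff)
qed

text \<open>A common factor would make -cos(pi / b) = cos(pi - pi / b) a root of \<open>M a\<close>.
  As a is odd, this yields cos(a pi / b) = 1, so a is an even multiple of b: a parity
  contradiction.\<close>

lemma coprime_M_M_reflect: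
  assumes "odd a" "b > 0"
  shows "coprime (M b) (M a \<circ>\<^sub>p [:0, -1:])"
proof (intro irreducible_coprime irreducible_M notI)
  assume "M b dvd M a \<circ>\<^sub>p [:0, -1:]"
  from rpoly_dvd_root[OF this rpoly_M] have "rpoly (M a) (cos (pi - pi / real b)) = 0"
    by (simp add: of_rat_minus)
  hence "rpoly (cheb_T a) (cos (pi - pi / real b)) = -1"
    using assms by (intro rpoly_M_imp_cheb_T) (auto intro: odd_pos)
  hence "cos (real a * (pi - pi / real b)) = -1" by (simp only: cheb_T_cos)
  also have "real a * (pi - pi / real b) = real a * pi - real a * (pi / real b)"
    by (simp add: algebra_simps)
  also have "cos \<dots> = - cos (real a * (pi / real b))"
    using assms(1) by (simp add: cos_diff)
  finally obtain n :: int where "real a * (pi / real b) = of_int n * 2 * pi"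
    by (auto simp: cos_one_2pi_int)
  hence "real a = of_int (2 * n * int b)" using assms by (simp add: field_simps)
  hence "int a = 2 * n * int b" by linarith
  hence "even (int a)" by simp
  thus False using assms by simp
qed

lemma coprime_M_reflect:
  assumes "a > 0" "b > 0" "a \<noteq> b"
  shows "coprime (M a \<circ>\<^sub>p [:0, -1:]) (M b \<circ>\<^sub>p [:0, -1:])"
proof (intro irreducible_coprime irreducible_pcompose_reflect irreducible_M notI)
  assume "M a \<circ>\<^sub>p [:0, -1:] dvd M b \<circ>\<^sub>p [:0, -1:]"
  then obtain q where "M b \<circ>\<^sub>p [:0, -1:] = (M a \<circ>\<^sub>p [:0, -1:]) * q" by (elim dvdE)
  hence "M b = M a * (q \<circ>\<^sub>p [:0, -1:])" by (metis pcompose_mult pcompose_reflect_reflect)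
  hence "M a dvd M b" by simp
  hence "M a dvd 1" using coprime_M[OF assms] by (metis coprime_common_divisor dvd_refl)
  thus False using irreducible_M[of a] by (simp add: irreducible_def)
qed

lemma prod_dvd_if_pairwise_coprime:
  fixes f :: "'a \<Rightarrow> 'b :: {semiring_gcd}"
  assumes "finite A" "\<And>a. a \<in> A \<Longrightarrow> f a dvd q"
    "\<And>a b. a \<in> A \<Longrightarrow> b \<in> A \<Longrightarrow> a \<noteq> b \<Longrightarrow> coprime (f a) (f b)"
  shows "prod f A dvd q"
  using assms
proof (induction A rule: finite_induct)
  case (insert a A)
  have "coprime (f a) (prod f A)"
    using insert by (intro prod_coprime_right) auto
  moreover have "f a dvd q" "prod f A dvd q" using insert by auto
  ultimately have "f a * prod f A dvd q" by (rule divides_mult[rotated 2])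
  thus ?case using insert by simp
qed simp

text \<open>All \<open>cos (j \<pi> / n)\<close> with \<open>j\<close> coprime to \<open>2 n\<close> are roots; \<open>j\<close> and \<open>2 n - j\<close> give the same one.\<close>

lemma totient_le_degree_M:
  assumes "n \<ge> 2"
  shows "totient (2 * n) \<le> 2 * degree (M n)"
proof -
  define A where "A = {j \<in> totatives (2 * n). j < n}"
  have fin: "finite A" by (simp add: A_def)
  have "totatives (2 * n) \<subseteq> A \<union> (\<lambda>j. 2 * n - j) ` A"
  proof
    fix j assume j: "j \<in> totatives (2 * n)"
    hence cop: "coprime j (2 * n)" and le: "j > 0" "j \<le> 2 * n" by (auto simp: in_totatives_iff)
    show "j \<in> A \<union> (\<lambda>j. 2 * n - j) ` A"
    proof (cases "j < n")
      case True
      thus ?thesis using j by (simp add: A_def)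
    next
      case False
      \<comment> \<open>n and 2 n share the divisor n >= 2 with 2 n.\<close>
      have "j \<noteq> n" "j \<noteq> 2 * n" using cop assms by (auto simp: coprime_commute)
      hence *: "n < j" "j < 2 * n" using False le by auto
      have "coprime (2 * n - j) (2 * n)"
        using cop le by (metis coprime_iff_gcd_eq_1 gcd_diff2_nat)
      hence "2 * n - j \<in> A" using * by (auto simp: A_def in_totatives_iff)
      moreover have "j = 2 * n - (2 * n - j)" using * by simp
      ultimately show ?thesis by blast
    qed
  qed
  hence "totient (2 * n) \<le> card (A \<union> (\<lambda>j. 2 * n - j) ` A)"
    unfolding totient_def using fin by (intro card_mono) auto
  also have "\<dots> \<le> card A + card ((\<lambda>j. 2 * n - j) ` A)" by (rule card_Un_le)
  also have "\<dots> \<le> 2 * card A" using card_image_le[OF fin] by simp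
  also have "card A \<le> degree (M n)"
  proof -
    let ?p = "map_poly of_rat (M n) :: real poly"
    have p: "?p \<noteq> 0" by (simp add: map_poly_eq_0_iff)
    \<comment> \<open>The angles j pi / n with j < n lie in [0, pi], where cosine is
      injective.\<close>
    have "inj_on (\<lambda>j. cos (real j * (pi / real n))) A"
    proof (rule inj_onI)
      fix i j assume ij: "i \<in> A" "j \<in> A" "cos (real i * (pi / real n)) = cos (real j * (pi / real n))"
      have bounds: "0 \<le> real k * (pi / real n)" "real k * (pi / real n) \<le> pi" if "k \<in> A" for k
      proof -
        have "real k / real n \<le> 1" using that assms by (simp add: A_def)
        hence "real k / real n * pi \<le> 1 * pi" by (rule mult_right_mono) simp
        thus "real k * (pi / real n) \<le> pi" by simp
      qed simp
      have "real i * (pi / real n) = real j * (pi / real n)"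
        by (rule cos_inj_pi[OF bounds[OF ij(1)] bounds[OF ij(2)] ij(3)])
      thus "i = j" using assms by simp
    qed
    hence "card A = card ((\<lambda>j. cos (real j * (pi / real n))) ` A)" by (simp add: card_image)
    also have "\<dots> \<le> card {x. poly ?p x = 0}"
    proof (intro card_mono poly_roots_finite p subsetI)
      fix x assume "x \<in> (\<lambda>j. cos (real j * (pi / real n))) ` A"
      then obtain j where j: "coprime j (2 * n)" "x = cos (real j * (pi / real n))"
        by (auto simp: A_def in_totatives_iff)
      have "cis (pi / real n) ^ (2 * n) = 1" using assms by (simp add: Complex.DeMoivre)
      thus "x \<in> {x. poly ?p x = 0}"
        using rpoly_cos_conj[of "2 * n" j "pi / real n" "M n"] assms j by simp
    qed
    also have "\<dots> \<le> degree ?p" by (rule card_poly_roots_bound[OF p])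
    also have "\<dots> = degree (M n)" by (rule degree_map_poly) simp
    finally show ?thesis .
  qed
  finally show ?thesis by simp
qed

section \<open>The factorizations\<close>

text \<open>The cofactor has degree 0, and the leading coefficients make it 1. The later
  identifications of products and compositions all end with this comparison.\<close>

lemma poly_eq_if_dvd:
  fixes p q :: "'a :: field poly"
  assumes "p dvd q" "q \<noteq> 0" "degree q \<le> degree p" "lead_coeff p = lead_coeff q"
  shows "p = q"
proof -
  obtain r where r: "q = p * r" using assms(1) by (elim dvdE)
  hence nz: "p \<noteq> 0" "r \<noteq> 0" using assms(2) by auto
  hence "degree q = degree p + degree r" unfolding r by (rule degree_mult_eq)
  hence "degree r = 0" using assms(3) by simp
  then obtain c where c: "r = [:c:]" by (elim degree_eq_zeroE)
  have "lead_coeff q = lead_coeff p * c" unfolding r by (simp add: lead_coeff_mult c)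
  moreover have "lead_coeff p \<noteq> 0" using nz by simp
  ultimately have "c = 1" using assms(4) by (metis mult_cancel_left1)
  thus ?thesis using r c by simp
qed

section \<open>Totients of odd numbers times powers of two\<close>

lemma totient_two_power_mult_odd:
  assumes "odd d"
  shows "totient (2 ^ Suc i * d) = 2 ^ i * totient d"
proof -
  have "coprime (2 ^ Suc i) d" using assms by simp
  moreover have "totient (2 ^ Suc i) = 2 ^ i" using totient_prime_power_Suc[of 2 i] by simp
  ultimately show ?thesis by (simp only: totient_mult_coprime)
qed

lemma sum_totient_odd_divisors:
  assumes "odd N"
  shows "(\<Sum>d | d dvd N \<and> d \<noteq> 1. totient (2 * d)) = N - 1"
proof -
  have fin: "finite {d. d dvd N}" using assms by (auto intro: finite_divisors_nat odd_pos)
  have "{d. d dvd N} = insert 1 {d. d dvd N \<and> d \<noteq> 1}" by auto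
  hence "N = 1 + (\<Sum>d | d dvd N \<and> d \<noteq> 1. totient d)"
    using totient_divisor_sum[of N] fin by simp
  also have "(\<Sum>d | d dvd N \<and> d \<noteq> 1. totient d) = (\<Sum>d | d dvd N \<and> d \<noteq> 1. totient (2 * d))"
  proof (rule sum.cong[OF refl])
    fix d assume "d \<in> {d. d dvd N \<and> d \<noteq> 1}"
    hence "odd d" using assms by auto
    thus "totient d = totient (2 * d)" by (simp add: totient_double)
  qed
  finally show ?thesis by simp
qed

text \<open>sin(n x) vanishes at x = pi / b and at x = pi - pi / b, while sin x does not.\<close>

lemma cheb_V_root:
  assumes "b dvd n" "b \<ge> 2"
  shows "rpoly (cheb_V n) (cos (pi / real b)) = 0" "rpoly (cheb_V n) (- cos (pi / real b)) = 0"
proof -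
  obtain c where c: "n = b * c" using assms(1) by (elim dvdE)
  have "real n * (pi / real b) = real c * pi" using assms c by simp
  hence sin0: "sin (real n * (pi / real b)) = 0" by simp
  have "pi / real b < pi" using assms by (simp add: field_simps)
  hence sin: "sin (pi / real b) > 0" using assms by (intro sin_gt_zero) auto
  show "rpoly (cheb_V n) (cos (pi / real b)) = 0"
    using cheb_V_cos[of "pi / real b" n] sin0 sin by simp
  have "sin (real n * (pi - pi / real b)) = 0"
    using sin0 by (simp add: right_diff_distrib sin_diff)
  moreover have "sin (pi - pi / real b) \<noteq> 0" using sin by simp
  ultimately have "rpoly (cheb_V n) (cos (pi - pi / real b)) = 0"
    using cheb_V_cos[of "pi - pi / real b" n] by simp
  thus "rpoly (cheb_V n) (- cos (pi / real b)) = 0" by simp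
qed

text \<open>The sign comes from the reflections: t -> -t multiplies the leading coefficient of
  \<open>M d\<close> by (-1)^degree, and these degrees sum to m over \<open>D\<close>.\<close>

lemma cheb_V_odd_factorization:
  fixes m :: nat
  defines "N \<equiv> 2 * m + 1"
  defines "D \<equiv> {d. d dvd N \<and> d \<noteq> 1}"
  shows degree_M_odd_divisor: "d \<in> D \<Longrightarrow> 2 * degree (M d) = totient (2 * d)"
    and "cheb_V N = (-1) ^ m * (\<Prod>d\<in>D. M d * (M d \<circ>\<^sub>p [:0, -1:]))"
proof -
  let ?P = "\<lambda>d. M d * (M d \<circ>\<^sub>p [:0, -1:])"
  have fin: "finite D" unfolding D_def N_def by (rule finite_subset[OF _ finite_divisors_nat]) auto
  have D: "d \<ge> 2" "odd d" "d dvd N" if "d \<in> D" for d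
  proof -
    show "d dvd N" using that by (simp add: D_def)
    thus "odd d" unfolding N_def by (metis dvd_trans even_plus_one_iff dvd_triv_left)
    thus "d \<ge> 2" using that by (cases d) (auto simp: D_def Suc_le_eq)
  qed
  have degP: "degree (?P d) = 2 * degree (M d)" for d
    by (subst degree_mult_eq) (auto simp: pcompose_eq_0_iff degree_pcompose)
  have nzP: "?P d \<noteq> 0" for d by (simp add: pcompose_eq_0_iff)
  have lb: "totient (2 * d) \<le> 2 * degree (M d)" if "d \<in> D" for d
    using totient_le_degree_M D(1)[OF that] .
  have "prod ?P D dvd cheb_V N"
  proof (rule prod_dvd_if_pairwise_coprime[OF fin])
    fix d assume d: "d \<in> D"
    have "M d dvd cheb_V N" using cheb_V_root D[OF d] by (intro M_dvd) blast
    moreover have "M d \<circ>\<^sub>p [:0, -1:] dvd cheb_V N"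
    proof -
      have "M d dvd cheb_V N \<circ>\<^sub>p [:0, -1:]"
        using cheb_V_root(2)[of d N] D[OF d] by (intro M_dvd) (simp add: of_rat_minus)
      then obtain q where "cheb_V N \<circ>\<^sub>p [:0, -1:] = M d * q" by (elim dvdE)
      hence "cheb_V N = (M d \<circ>\<^sub>p [:0, -1:]) * (q \<circ>\<^sub>p [:0, -1:])"
        by (metis pcompose_mult pcompose_reflect_reflect)
      thus ?thesis by simp
    qed
    moreover have "coprime (M d) (M d \<circ>\<^sub>p [:0, -1:])"
      using D[OF d] by (intro coprime_M_M_reflect) auto
    ultimately show "?P d dvd cheb_V N" by (rule divides_mult)
  next
    fix a b assume ab: "a \<in> D" "b \<in> D" "a \<noteq> b"
    have "a > 0" "b > 0" "odd a" "odd b" using D[OF ab(1)] D[OF ab(2)] by auto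
    thus "coprime (?P a) (?P b)"
      using ab(3) coprime_M[of a b] coprime_M_reflect[of a b]
        coprime_M_M_reflect[of b a] coprime_M_M_reflect[of a b]
      by (simp add: coprime_commute)
  qed
  moreover have degprod: "degree (prod ?P D) = (\<Sum>d\<in>D. 2 * degree (M d))"
    by (subst degree_prod_eq_sum_degree) (use nzP degP in auto)
  moreover have V: "degree (cheb_V N) = N - 1" "lead_coeff (cheb_V N) = 2 ^ (2 * m)"
    using degree_cheb_V[of "2 * m"] lead_coeff_cheb_V[of "2 * m"] by (simp_all add: N_def)
  moreover have Vnz: "cheb_V N \<noteq> 0" using V(2) by force
  ultimately have "(\<Sum>d\<in>D. 2 * degree (M d)) \<le> N - 1"
    using dvd_imp_degree_le[of "prod ?P D" "cheb_V N"] by linarith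
  moreover have tot: "(\<Sum>d\<in>D. totient (2 * d)) = N - 1"
    unfolding D_def by (rule sum_totient_odd_divisors) (simp add: N_def)
  moreover have "(\<Sum>d\<in>D. totient (2 * d)) \<le> (\<Sum>d\<in>D. 2 * degree (M d))"
    by (intro sum_mono lb)
  ultimately have eq: "(\<Sum>d\<in>D. totient (2 * d)) = (\<Sum>d\<in>D. 2 * degree (M d))" by simp
  show deg: "2 * degree (M d) = totient (2 * d)" if "d \<in> D" for d
    using sum_mono_inv[OF eq lb that fin] by simp
  have "lead_coeff (prod ?P D) = (\<Prod>d\<in>D. (-1) ^ degree (M d) * 4 ^ degree (M d))"
    unfolding lead_coeff_prod
  proof (rule prod.cong[OF refl])
    fix d assume d: "d \<in> D"
    \<comment> \<open>Now that the degree is known, the normalizing exponent in \<open>M_def\<close>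
      equals it.\<close>
    have "lead_coeff (M d) = 2 ^ degree (M d)"
      using deg[OF d] by (simp only: lead_coeff_M[of d] flip: deg[OF d]) simp
    moreover have "lead_coeff (M d \<circ>\<^sub>p [:0, -1:]) = lead_coeff (M d) * (-1) ^ degree (M d)"
      by (subst lead_coeff_comp) auto
    ultimately show "lead_coeff (?P d) = (-1) ^ degree (M d) * 4 ^ degree (M d)"
      by (simp only: lead_coeff_mult) (simp flip: power_mult_distrib)
  qed
  also have "\<dots> = (-1) ^ (\<Sum>d\<in>D. degree (M d)) * 4 ^ (\<Sum>d\<in>D. degree (M d))"
    by (simp only: prod.distrib power_sum)
  also have "(\<Sum>d\<in>D. degree (M d)) = m"
    using eq tot by (simp only: N_def flip: sum_distrib_left)
  finally have lead: "lead_coeff (prod ?P D) = (-1) ^ m * 4 ^ m" .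
  have "smult ((-1) ^ m) (prod ?P D) = cheb_V N"
  proof (rule poly_eq_if_dvd)
    show "smult ((-1) ^ m) (prod ?P D) dvd cheb_V N"
      using \<open>prod ?P D dvd cheb_V N\<close> by (intro smult_dvd) auto
    show "degree (cheb_V N) \<le> degree (smult ((-1) ^ m) (prod ?P D))"
      using V(1) tot eq degprod by simp
    show "lead_coeff (smult ((-1) ^ m) (prod ?P D)) = lead_coeff (cheb_V N)"
      using lead V(2) by (simp only: lead_coeff_smult) (simp add: power_mult flip: power_add mult.assoc mult_2)
  qed (rule Vnz)
  moreover have "smult ((-1) ^ m) q = (-1) ^ m * q" for q :: "rat poly"
    by (cases "even m") auto
  ultimately show "cheb_V N = (-1) ^ m * prod ?P D" by simp
qed

text \<open>If N = d c, then c is odd and 2^k N times pi / (2^(k+1) d) is c pi / 2, a zero of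
  cosine. Indexing by \<open>M (2 ^ Suc k * d)\<close> treats d = 1 like every other divisor;
  compositions enter only afterwards.\<close>

lemma cheb_T_factorization_M:
  fixes N k :: nat
  assumes "odd N"
  shows degree_M_even: "d dvd N \<Longrightarrow> 2 * degree (M (2 ^ Suc k * d)) = totient (2 * (2 ^ Suc k * d))"
    and "cheb_T (2 ^ k * N) = smult (1 / 2) (\<Prod>d | d dvd N. M (2 ^ Suc k * d))"
proof -
  let ?D = "{d. d dvd N}" and ?n = "2 ^ k * N" and ?P = "\<lambda>d. M (2 ^ Suc k * d)"
  have N: "N > 0" using assms by (rule odd_pos)
  have fin: "finite ?D" using N by (intro finite_divisors_nat)
  have lb: "totient (2 * (2 ^ Suc k * d)) \<le> 2 * degree (?P d)" if "d \<in> ?D" for d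
  proof (rule totient_le_degree_M)
    have "d > 0" using that N by (auto intro: Nat.gr0I)
    thus "2 \<le> 2 ^ Suc k * d" by (simp add: Suc_le_eq)
  qed
  have "prod ?P ?D dvd cheb_T ?n"
  proof (rule prod_dvd_if_pairwise_coprime[OF fin])
    fix d assume "d \<in> ?D"
    then obtain c where c: "N = d * c" by (auto elim: dvdE)
    have "odd c" "d > 0" using assms N by (auto simp: c)
    obtain e where e: "c = 2 * e + 1" using \<open>odd c\<close> by (elim oddE)
    have "real ?n * (pi / real (2 ^ Suc k * d)) = real c * pi / 2"
      using \<open>d > 0\<close> by (simp add: c)
    also have "\<dots> = real e * pi + pi / 2" by (simp add: e field_simps)
    finally have "cos (real ?n * (pi / real (2 ^ Suc k * d))) = 0"
      by (simp only:) (simp add: cos_add)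
    thus "?P d dvd cheb_T ?n" by (intro M_dvd) (simp only: cheb_T_cos)
  next
    fix a b assume "a \<in> ?D" "b \<in> ?D" "a \<noteq> b"
    thus "coprime (?P a) (?P b)" using N by (intro coprime_M) (auto intro: Nat.gr0I)
  qed
  moreover have degprod: "degree (prod ?P ?D) = (\<Sum>d\<in>?D. degree (?P d))"
    by (rule degree_prod_eq_sum_degree) simp
  moreover have Tnz: "cheb_T ?n \<noteq> 0"
    using degree_cheb_T[of ?n] N by auto
  ultimately have "(\<Sum>d\<in>?D. degree (?P d)) \<le> ?n"
    using degree_cheb_T[of ?n] by (metis dvd_imp_degree_le)
  hence "(\<Sum>d\<in>?D. 2 * degree (?P d)) \<le> 2 * ?n" by (simp flip: sum_distrib_left)
  moreover have tot: "(\<Sum>d\<in>?D. totient (2 * (2 ^ Suc k * d))) = 2 * ?n"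
  proof -
    \<comment> \<open>For odd d the power 2^(k+2) contributes the constant factor 2^(k+1), and the
      totients of the divisors sum to N.\<close>
    have "(\<Sum>d\<in>?D. totient (2 * (2 ^ Suc k * d))) = (\<Sum>d\<in>?D. 2 ^ Suc k * totient d)"
    proof (rule sum.cong[OF refl])
      fix d assume "d \<in> ?D"
      hence "odd d" using assms by auto
      thus "totient (2 * (2 ^ Suc k * d)) = 2 ^ Suc k * totient d"
        using totient_two_power_mult_odd[OF \<open>odd d\<close>, of "Suc k"] by (simp only: power_Suc mult.assoc)
    qed
    also have "\<dots> = 2 * ?n" by (simp only: totient_divisor_sum flip: sum_distrib_left) simp
    finally show ?thesis .
  qed
  moreover have "(\<Sum>d\<in>?D. totient (2 * (2 ^ Suc k * d))) \<le> (\<Sum>d\<in>?D. 2 * degree (?P d))"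
    by (intro sum_mono lb)
  ultimately have eq: "(\<Sum>d\<in>?D. totient (2 * (2 ^ Suc k * d))) = (\<Sum>d\<in>?D. 2 * degree (?P d))"
    by linarith
  have deg: "2 * degree (?P d) = totient (2 * (2 ^ Suc k * d))" if "d \<in> ?D" for d
    using sum_mono_inv[OF eq lb that fin] by simp
  thus "d dvd N \<Longrightarrow> 2 * degree (?P d) = totient (2 * (2 ^ Suc k * d))" by simp
  have sumdeg: "(\<Sum>d\<in>?D. degree (?P d)) = ?n"
  proof -
    have "2 * (\<Sum>d\<in>?D. degree (?P d)) = 2 * ?n" using eq tot by (simp only: sum_distrib_left)
    thus ?thesis by linarith
  qed
  have "lead_coeff (prod ?P ?D) = (\<Prod>d\<in>?D. 2 ^ degree (?P d))"
    unfolding lead_coeff_prod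
  proof (rule prod.cong[OF refl])
    fix d assume "d \<in> ?D"
    show "lead_coeff (?P d) = 2 ^ degree (?P d)"
      by (simp only: lead_coeff_M flip: deg[OF \<open>d \<in> ?D\<close>]) simp
  qed
  also have "\<dots> = 2 ^ ?n" by (simp only: sumdeg flip: power_sum)
  finally have lead: "lead_coeff (prod ?P ?D) = 2 ^ ?n" .
  have "smult (1 / 2) (prod ?P ?D) = cheb_T ?n"
  proof (rule poly_eq_if_dvd)
    show "smult (1 / 2) (prod ?P ?D) dvd cheb_T ?n"
      using \<open>prod ?P ?D dvd cheb_T ?n\<close> by (intro smult_dvd) auto
    show "degree (cheb_T ?n) \<le> degree (smult (1 / 2) (prod ?P ?D))"
      using degprod sumdeg degree_cheb_T[of ?n] by simp
    have n: "?n > 0" using N by simp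
    \<comment> \<open>The product has leading coefficient 2^n, but T_n only 2^(n-1): this is the
      source of the factor 1/2.\<close>
    have "(2 :: rat) ^ ?n = 2 * 2 ^ (?n - 1)" using n by (simp flip: power_Suc)
    thus "lead_coeff (smult (1 / 2) (prod ?P ?D)) = lead_coeff (cheb_T ?n)"
      by (simp only: lead_coeff_smult lead lead_coeff_cheb_T[OF n])
  qed (rule Tnz)
  thus "cheb_T ?n = smult (1 / 2) (prod ?P ?D)" ..
qed

text \<open>T_(2^i) sends cos(pi / (2^i d)) to cos(pi / d), so \<open>M (2 ^ i * d)\<close> divides
  the composition, and twice either degree is 2^i phi(d). For d = 1 the degree of \<open>M 1\<close>
  is 1 instead of phi(2) / 2, and the equality fails.\<close>

lemma M_pcompose_cheb_T:
  assumes "odd d" "d \<noteq> 1" "i > 0"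
  shows "M d \<circ>\<^sub>p cheb_T (2 ^ i) = M (2 ^ i * d)"
proof -
  obtain k where k: "i = Suc k" using assms(3) by (cases i) auto
  obtain e where e: "d = 2 * e + 1" using assms(1) by (elim oddE)
  \<comment> \<open>The degree formula is taken with N = d, as d divides itself.\<close>
  have degd: "2 * degree (M d) = totient d"
    using degree_M_odd_divisor[of d e] assms(1,2) by (simp only: totient_double flip: e) simp
  have degi: "2 * degree (M (2 ^ i * d)) = 2 ^ i * totient d"
    using degree_M_even[OF assms(1) dvd_refl, of k] totient_two_power_mult_odd[OF assms(1), of i]
    by (simp only: k power_Suc mult.assoc)
  have "M (2 ^ i * d) = M d \<circ>\<^sub>p cheb_T (2 ^ i)"
  proof (rule poly_eq_if_dvd)
    have "real (2 ^ i) * (pi / real (2 ^ i * d)) = pi / real d" by simp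
    thus "M (2 ^ i * d) dvd M d \<circ>\<^sub>p cheb_T (2 ^ i)"
      by (intro M_dvd) (simp only: rpoly_pcompose cheb_T_cos rpoly_M)
    show "M d \<circ>\<^sub>p cheb_T (2 ^ i) \<noteq> 0"
      by (simp add: pcompose_eq_0_iff degree_cheb_T)
    have "2 * degree (M d \<circ>\<^sub>p cheb_T (2 ^ i)) = 2 * degree (M (2 ^ i * d))"
      by (simp only: degree_pcompose degree_cheb_T degi flip: mult.assoc) (simp only: degd mult.commute)
    thus "degree (M d \<circ>\<^sub>p cheb_T (2 ^ i)) \<le> degree (M (2 ^ i * d))" by linarith
    have "lead_coeff (M d \<circ>\<^sub>p cheb_T (2 ^ i)) = lead_coeff (M d) * lead_coeff (cheb_T (2 ^ i)) ^ degree (M d)"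
      by (rule lead_coeff_comp) (simp add: degree_cheb_T)
    also have "\<dots> = 2 ^ degree (M d) * (2 ^ (2 ^ i - 1)) ^ degree (M d)"
    proof -
      have "totient (2 * d) div 2 = degree (M d)" using degd assms(1) by (simp add: totient_double)
      thus ?thesis by (simp only: lead_coeff_M) (simp add: lead_coeff_cheb_T)
    qed
    also have "\<dots> = (2 * 2 ^ (2 ^ i - 1)) ^ degree (M d)" by (simp only: power_mult_distrib)
    also have "2 * 2 ^ (2 ^ i - 1) = (2 :: rat) ^ (2 ^ i)" by (simp flip: power_Suc)
    also have "((2 :: rat) ^ (2 ^ i)) ^ degree (M d) = 2 ^ (2 ^ i * degree (M d))" by (simp only: power_mult)
    also have "2 ^ i * degree (M d) = totient (2 * (2 ^ i * d)) div 2"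
    proof -
      have "totient (2 * (2 ^ i * d)) = 2 ^ i * totient d"
        using totient_two_power_mult_odd[OF assms(1), of i] by (simp only: power_Suc mult.assoc)
      also have "\<dots> = 2 * (2 ^ i * degree (M d))" by (simp only: degd[symmetric] mult.left_commute)
      finally show ?thesis by simp
    qed
    finally show "lead_coeff (M (2 ^ i * d)) = lead_coeff (M d \<circ>\<^sub>p cheb_T (2 ^ i))"
      by (simp only: lead_coeff_M)
  qed
  thus ?thesis ..
qed

text \<open>The divisor 1 is split off because \<open>M_pcompose_cheb_T\<close> rewrites only the
  factors with d > 1.\<close>

lemma cheb_T_factorization:
  "cheb_T (2 ^ k * (2 * m + 1)) =
     smult (1 / 2) (M (2 ^ (k + 1)) *
       (\<Prod>d | d dvd 2 * m + 1 \<and> d \<noteq> 1. M d \<circ>\<^sub>p cheb_T (2 ^ (k + 1))))"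
proof -
  let ?N = "2 * m + 1"
  let ?D = "{d. d dvd ?N \<and> d \<noteq> 1}"
  have odd: "odd ?N" by simp
  have fin: "finite ?D" by (rule finite_subset[OF _ finite_divisors_nat[of ?N]]) auto
  have eq: "{d. d dvd ?N} = insert 1 ?D" by auto
  have "(\<Prod>d | d dvd ?N. M (2 ^ Suc k * d)) = M (2 ^ Suc k) * (\<Prod>d\<in>?D. M (2 ^ Suc k * d))"
    unfolding eq using fin by (subst prod.insert) auto
  also have "(\<Prod>d\<in>?D. M (2 ^ Suc k * d)) = (\<Prod>d\<in>?D. M d \<circ>\<^sub>p cheb_T (2 ^ Suc k))"
  proof (rule prod.cong[OF refl])
    fix d assume d: "d \<in> ?D"
    hence "odd d" using odd by (metis (lifting) dvd_trans mem_Collect_eq)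
    thus "M (2 ^ Suc k * d) = M d \<circ>\<^sub>p cheb_T (2 ^ Suc k)" using d M_pcompose_cheb_T[of d "Suc k"] by simp
  qed
  finally show ?thesis
    using cheb_T_factorization_M(2)[OF odd, of k] by (simp only: Suc_eq_plus1)
qed

lemma cheb_V_factorization:
  "cheb_V (2 ^ k * (2 * m + 1)) =
     (-1) ^ m * (\<Prod>i = 1..k. M (2 ^ i)) *
     (\<Prod>d | d dvd 2 * m + 1 \<and> d \<noteq> 1.
        (\<Prod>i = 1..k. M d \<circ>\<^sub>p cheb_T (2 ^ i)) * (M d * (M d \<circ>\<^sub>p [:0, -1:])))"
proof (induction k)
  case 0
  show ?case using cheb_V_odd_factorization(2)[of m] by simp
next
  case (Suc k)
  let ?n = "2 ^ k * (2 * m + 1)" and ?D = "{d. d dvd 2 * m + 1 \<and> d \<noteq> 1}"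
  have "cheb_V (2 ^ Suc k * (2 * m + 1)) = smult 2 (cheb_V ?n * cheb_T ?n)"
    using cheb_V_double[of ?n] by (simp only: power_Suc mult.assoc)
  \<comment> \<open>The 2 from doubling cancels the 1/2 of T_n, and the remaining factors are
    exactly those of index i = k + 1.\<close>
  also have "\<dots> = cheb_V ?n * (M (2 ^ Suc k) * (\<Prod>d\<in>?D. M d \<circ>\<^sub>p cheb_T (2 ^ Suc k)))"
    unfolding cheb_T_factorization by simp
  finally show ?case unfolding Suc
    by (simp only: prod.distrib prod.nat_ivl_Suc' le_add1 plus_1_eq_Suc Suc_le_mono le0 One_nat_def mult_ac)
qed

theorem proposition4:
  fixes k m :: nat
  shows "cheb_V (2 ^ k * (2 * m + 1)) =
           (-1) ^ m * (\<Prod>i = 1..k. M (2 ^ i)) *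
           (\<Prod>d | d dvd 2 * m + 1 \<and> d \<noteq> 1.
              (\<Prod>i = 1..k. M d \<circ>\<^sub>p cheb_T (2 ^ i)) * (M d * (M d \<circ>\<^sub>p [:0, -1:])))
       \<and> cheb_T (2 ^ k * (2 * m + 1)) =
           smult (1 / 2) (M (2 ^ (k + 1)) *
             (\<Prod>d | d dvd 2 * m + 1 \<and> d \<noteq> 1. M d \<circ>\<^sub>p cheb_T (2 ^ (k + 1))))
       \<and> (\<forall>i \<in> {1..k + 1}. irreducible (M (2 ^ i)))
       \<and> (\<forall>d. d dvd 2 * m + 1 \<and> d \<noteq> 1 \<longrightarrow>
           irreducible (M d) \<and> irreducible (M d \<circ>\<^sub>p [:0, -1:]) \<and>
           (\<forall>i \<in> {1..k + 1}. irreducible (M d \<circ>\<^sub>p cheb_T (2 ^ i))))"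
proof (intro conjI ballI allI impI cheb_V_factorization cheb_T_factorization
    irreducible_M irreducible_pcompose_reflect)
  fix d i assume d: "d dvd 2 * m + 1 \<and> d \<noteq> 1" and i: "i \<in> {1..k + 1}"
  have "odd (2 * m + 1)" by simp
  hence "odd d" using d dvd_trans by blast
  \<comment> \<open>The composition is itself the minimal polynomial of a cosine up to a scalar,
    hence irreducible.\<close>
  hence "M d \<circ>\<^sub>p cheb_T (2 ^ i) = M (2 ^ i * d)" using d i by (intro M_pcompose_cheb_T) auto
  thus "irreducible (M d \<circ>\<^sub>p cheb_T (2 ^ i))" by (simp only: irreducible_M)
qed

end
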